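(* Let $G=(V,E)$ be a connected graph with at least two vertices. Then for every $v_i\in V$, $$\mathcal{RE}_G(v_i)\geq\frac{1}{d_i}\sum_{j:\, v_j\sim v_i}\frac{1}{d_j},$$ where equality holds if and only if $G$ is a complete bipartite graph $K_{n_1,n_2}$.
   Context: All graphs are simple. For a graph $G$ with vertices $v_1,\dots,v_n$, let $d_i$ be the degree of $v_i$; $v_j\sim v_i$ means that $v_j$ and $v_i$ are adjacent. The Randić matrix $R(G)=(R_{ij})$ is the $n\times n$ matrix with $R_{ij}=\frac{1}{\sqrt{d_id_j}}$ if $v_i\sim v_j$ and $R_{ij}=0$ otherwise. Put $|R(G)|=(R(G)R(G)^* )^{1/2}$ (positive semidefinite square root), where $*$ denotes conjugate transpose. The Randić energy of the vertex $v_i$ is $\mathcal{RE}_G(v_i)=|R(G)|_{ii}$, the $i$-th diagonal entry of $|R(G)|$. $K_{n_1,n_2}$ denotes the complete bipartite graph with parts of sizes $n_1$ and $n_2$. *)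

theory Defs
  imports
    Complex_Main
    "Graph_Theory.Graph_Theory"
    "Jordan_Normal_Form.Schur_Decomposition"
begin

definition positive_semidefinite :: "'a :: conjugatable_ordered_field mat \<Rightarrow> bool" where
  "positive_semidefinite A \<longleftrightarrow> square_mat A \<and> mat_adjoint A = A
     \<and> (\<forall>x \<in> carrier_vec (dim_row A). 0 \<le> (A *\<^sub>v x) \<bullet>c x)"

definition psd_sqrt :: "'a :: conjugatable_ordered_field mat \<Rightarrow> 'a mat" where
  "psd_sqrt A = (THE B. positive_semidefinite B \<and> B * B = A)"

definition mat_abs :: "'a :: conjugatable_ordered_field mat \<Rightarrow> 'a mat" where
  "mat_abs A = psd_sqrt (A * mat_adjoint A)"

text \<open>
  Simple graphs are finite loop-free symmetric digraphs without parallel arcs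
  (locale \<^locale>\<open>graph\<close>), so an edge is a pair of opposite arcs and the out-degree of a
  vertex counts its neighbours. The list \<open>vs\<close> enumerates the vertices without repetition,
  \<open>vs ! i\<close> being $v_{i+1}$.
\<close>

definition vertex_degree :: "('v, 'e) pre_digraph \<Rightarrow> 'v \<Rightarrow> nat" where
  "vertex_degree G v = out_degree G v"

text \<open>
  The matrix is taken over the reals, where \<^const>\<open>mat_adjoint\<close> is transposition; the positive
  semidefinite square root of a real positive semidefinite matrix is the same real matrix
  whether it is formed over the reals or over the complex numbers.
\<close>

definition randic_matrix :: "('v, 'e) pre_digraph \<Rightarrow> 'v list \<Rightarrow> real mat" where
  "randic_matrix G vs = mat (length vs) (length vs) (\<lambda>(i, j).
     if vs ! i \<rightarrow>\<^bsub>G\<^esub> vs ! j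
     then 1 / sqrt (real (vertex_degree G (vs ! i)) * real (vertex_degree G (vs ! j))) else 0)"

definition randic_energy :: "('v, 'e) pre_digraph \<Rightarrow> 'v list \<Rightarrow> nat \<Rightarrow> real" where
  "randic_energy G vs i = mat_abs (randic_matrix G vs) $$ (i, i)"

end

theory Submission
  imports Defs
    "Jordan_Normal_Form.Jordan_Normal_Form_Existence"
    "HOL-Analysis.Convex"
begin

text \<open>
  Write \<open>R\<close> for the Randic matrix and \<open>B = |R|\<close>, so that \<open>B\<close> is positive semidefinite and
  \<open>B\<^sup>2 = R\<^sup>2\<close>. The right-hand side of the inequality is the diagonal entry \<open>(R\<^sup>2)\<^sub>i\<^sub>i\<close>, so the claim
  compares the diagonals of \<open>B\<close> and \<open>B\<^sup>2\<close>.

  By the Cauchy-Schwarz inequality \<open>R\<close> does not increase the Euclidean norm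
  (\<open>normalized_adjacency_contraction\<close>), hence neither does \<open>B\<close>. A positive semidefinite
  contraction satisfies \<open>(B x) \<bullet> (B x) \<le> (B x) \<bullet> x\<close>, with equality only if \<open>B (B x) = B x\<close>
  (\<open>psd_contraction\<close>); the unit vectors give the inequality. Equality at every vertex means
  \<open>B\<^sup>2 = B\<close>, that is \<open>R\<^sup>4 = R\<^sup>2\<close>, and for symmetric \<open>R\<close> this is the same as \<open>R\<^sup>3 = R\<close>
  (\<open>mat_abs_diag_eq_square_iff\<close>).

  The equation \<open>R\<^sup>3 = R\<close> is combinatorial. The entries of \<open>R\<close> are nonnegative with support the edges,
  so it forces the endpoints of every walk of length three to be adjacent. Conversely, under
  this closure property all neighbours of a vertex have the same neighbourhood, and the equation
  can be computed entrywise (\<open>normalized_adjacency_cube_iff\<close>). In a connected loop-free graph the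
  closure property characterises the complete bipartite graphs: around an edge \<open>ab\<close> the two
  neighbourhoods are the two parts (\<open>complete_bipartite_iff_three_walks_closed\<close>).

  To speak about \<open>|R|\<close> at all, a positive semidefinite matrix must have exactly one positive
  semidefinite square root. Both halves come from diagonalising a real symmetric
  matrix, which is obtained here from its Jordan normal form.
\<close>

section \<open>Diagonalisation of real symmetric matrices\<close>

lemma mat_adjoint_real: "mat_adjoint (A :: real mat) = A\<^sup>T"
  by (rule eq_matI) (auto simp: mat_adjoint_def mat_of_rows_index)

lemma positive_semidefinite_real_iff:
  assumes "(A :: real mat) \<in> carrier_mat n n"
  shows "positive_semidefinite A \<longleftrightarrow> A\<^sup>T = A \<and> (\<forall>x \<in> carrier_vec n. 0 \<le> (A *\<^sub>v x) \<bullet> x)"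
  using assms unfolding positive_semidefinite_def mat_adjoint_real by auto

lemma symmetric_mat_scalar_prod:
  assumes "(A :: real mat) \<in> carrier_mat n n" "A\<^sup>T = A" "x \<in> carrier_vec n" "y \<in> carrier_vec n"
  shows "(A *\<^sub>v x) \<bullet> y = x \<bullet> (A *\<^sub>v y)"
  using transpose_vec_mult_scalar[OF assms(1,4,3)] assms(2) by simp

lemma square_norm_nonneg: "0 \<le> (x :: real vec) \<bullet> x"
  using conjugate_square_ge_0_vec[of x] by simp

lemma square_norm_eq_0_iff:
  assumes "(x :: real vec) \<in> carrier_vec n"
  shows "x \<bullet> x = 0 \<longleftrightarrow> x = 0\<^sub>v n"
  using conjugate_square_eq_0_vec[OF assms] by simp

text \<open>
  For symmetric \<open>A\<close> the squared norm of \<open>A x\<close> is \<open>x \<bullet> A (A x)\<close>. This is what excludes Jordan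
  blocks of size greater than one, and it later cancels a factor \<open>R\<close> in \<open>R\<^sup>4 = R\<^sup>2\<close>.
\<close>

lemma symmetric_kernel_square:
  assumes "(A :: real mat) \<in> carrier_mat n n" "A\<^sup>T = A" "x \<in> carrier_vec n" "A *\<^sub>v (A *\<^sub>v x) = 0\<^sub>v n"
  shows "A *\<^sub>v x = 0\<^sub>v n"
proof -
  have "(A *\<^sub>v x) \<bullet> (A *\<^sub>v x) = x \<bullet> (A *\<^sub>v (A *\<^sub>v x))"
    using symmetric_mat_scalar_prod[of A n x "A *\<^sub>v x"] assms by simp
  also have "\<dots> = 0" using assms by simp
  finally show ?thesis
    using square_norm_eq_0_iff[of "A *\<^sub>v x" n] assms by simp
qed

lemma eigenvalue_symmetric_real:
  fixes A :: "real mat"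
  assumes A: "A \<in> carrier_mat n n" and sym: "A\<^sup>T = A"
    and ev: "eigenvalue (map_mat complex_of_real A) a"
  shows "a \<in> \<real>"
proof -
  let ?C = "map_mat complex_of_real A"
  have C: "?C \<in> carrier_mat n n" using A by simp
  obtain v where v: "v \<in> carrier_vec n" "v \<noteq> 0\<^sub>v n" and eq: "?C *\<^sub>v v = a \<cdot>\<^sub>v v"
    using ev A unfolding eigenvalue_def eigenvector_def by auto
  have Ct: "?C\<^sup>T = ?C" using sym A by (metis map_mat_transpose)
  have conj: "?C *\<^sub>v conjugate v = conjugate (?C *\<^sub>v v)"
    by (rule eq_vecI) (use A v in \<open>auto simp: scalar_prod_def\<close>)
  have "a * (v \<bullet>c v) = (?C *\<^sub>v v) \<bullet>c v" using eq v by simp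
  also have "\<dots> = v \<bullet> (?C *\<^sub>v conjugate v)"
    using transpose_vec_mult_scalar[OF C _ v(1), of "conjugate v"] Ct v
    by (metis C carrier_vec_conjugate comm_scalar_prod mult_mat_vec_carrier)
  also have "\<dots> = cnj a * (v \<bullet>c v)"
    unfolding conj eq using v by (simp add: conjugate_smult_vec)
  finally have "a = cnj a" using v by simp
  then show ?thesis by (simp add: Reals_cnj_iff)
qed

text \<open>
  Over the complex numbers the characteristic polynomial splits; its roots are eigenvalues and
  therefore real, and the factorisation transfers back because \<open>of_real\<close> is injective.
\<close>

lemma char_poly_symmetric_splits:
  fixes A :: "real mat"
  assumes A: "A \<in> carrier_mat n n" and sym: "A\<^sup>T = A"
  shows "\<exists>es. char_poly A = (\<Prod>e\<leftarrow>es. [:- e, 1:])"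
proof -
  interpret h: map_poly_inj_idom_hom complex_of_real ..
  let ?C = "map_mat complex_of_real A"
  have C: "?C \<in> carrier_mat n n" using A by simp
  obtain as where as: "char_poly ?C = (\<Prod>a\<leftarrow>as. [:- a, 1:])"
    using char_poly_factorized[OF C] by blast
  have "complex_of_real (Re a) = a" if "a \<in> set as" for a
  proof -
    have "poly (char_poly ?C) a = 0"
      unfolding as using that by (induction as) auto
    then show ?thesis
      using eigenvalue_symmetric_real[OF A sym] eigenvalue_root_char_poly[OF C] by simp
  qed
  then have "(\<Prod>a\<leftarrow>as. [:- a, 1:]) = map_poly complex_of_real (\<Prod>e\<leftarrow>map Re as. [:- e, 1:])"
    by (induction as) (auto simp: h.hom_mult map_poly_pCons simp del: mult_pCons_left)
  then have "map_poly complex_of_real (char_poly A) = map_poly complex_of_real (\<Prod>e\<leftarrow>map Re as. [:- e, 1:])"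
    using as of_real_hom.char_poly_hom[OF A] by metis
  then have "char_poly A = (\<Prod>e\<leftarrow>map Re as. [:- e, 1:])"
    by (rule h.injectivity)
  then show ?thesis by blast
qed

lemma jordan_matrix_entry:
  assumes "i < sum_list (map fst n_as)" "j < sum_list (map fst n_as)"
    and "(jordan_matrix n_as :: 'a :: {zero,one} mat) $$ (i, j) \<noteq> 0" "i \<noteq> j"
  shows "j = Suc i \<and> jordan_matrix n_as $$ (i, i) = jordan_matrix n_as $$ (j, j)"
  using assms
proof (induction n_as arbitrary: i j)
  case (Cons na n_as)
  obtain n a where na: "na = (n, a)" by (cases na)
  consider "i < n" "j < n" | "i < n" "\<not> j < n" | "\<not> i < n" "j < n" | "\<not> i < n" "\<not> j < n" by blast
  then show ?case
  proof cases
    case 4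
    then have "j - n = Suc (i - n) \<and> jordan_matrix n_as $$ (i - n, i - n) = jordan_matrix n_as $$ (j - n, j - n)"
      using Cons.prems by (intro Cons.IH) (auto simp: na jordan_matrix_Cons)
    then show ?thesis
      using 4 Cons.prems by (auto simp: na jordan_matrix_Cons)
  qed (use Cons.prems in \<open>auto simp: na jordan_matrix_Cons split: if_splits\<close>)
qed simp

lemma mult_unit_vec:
  assumes "(A :: 'a :: semiring_1 mat) \<in> carrier_mat n m" "i < m"
  shows "A *\<^sub>v unit_vec m i = col A i"
  by (rule eq_vecI) (use assms in auto)

lemma eq_mat_by_mult_vec:
  fixes A B :: "'a :: semiring_1 mat"
  assumes "A \<in> carrier_mat n m" "B \<in> carrier_mat n m"
    and "\<And>i. i < m \<Longrightarrow> A *\<^sub>v unit_vec m i = B *\<^sub>v unit_vec m i"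
  shows "A = B"
  by (rule mat_col_eqI) (use assms in \<open>auto simp: mult_unit_vec\<close>)

lemma mult_mat_zero_vec:
  assumes "(A :: 'a :: semiring_0 mat) \<in> carrier_mat n m"
  shows "A *\<^sub>v 0\<^sub>v m = 0\<^sub>v n"
  by (rule eq_vecI) (use assms in auto)

text \<open>
  If the Jordan form \<open>J\<close> had a nonzero entry above the diagonal, take the first one, at position
  \<open>(m, m + 1)\<close>, and let \<open>c\<close> be the eigenvalue of its block. Then \<open>J - c\<close> maps the unit vector of
  index \<open>m + 1\<close> to a nonzero multiple of that of index \<open>m\<close>, which it kills. So the symmetric matrix \<open>A - c\<close> would have
  a vector in the kernel of its square but not in its own kernel.
\<close>

lemma symmetric_diagonalizable:
  fixes A :: "real mat"
  assumes A: "A \<in> carrier_mat n n" and sym: "A\<^sup>T = A"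
  shows "\<exists>P Q d. P \<in> carrier_mat n n \<and> Q \<in> carrier_mat n n \<and> P * Q = 1\<^sub>m n \<and> Q * P = 1\<^sub>m n
    \<and> A = P * mat_diag n d * Q"
proof -
  obtain n_as where "jordan_nf A n_as"
    using char_poly_symmetric_splits[OF A sym] jordan_nf_exists[OF A] by blast
  then obtain P Q where w: "similar_mat_wit A (jordan_matrix n_as) P Q"
    unfolding jordan_nf_def similar_mat_def by blast
  define J where "J = jordan_matrix n_as"
  note W = similar_mat_witD2[OF A w, folded J_def]
  note [simp] = assoc_mult_mat[of _ n n _ n _ n]
  have n: "n = sum_list (map fst n_as)"
    using W(5) unfolding J_def by (metis carrier_matD(1) jordan_matrix_dim(1))
  have entry: "j = Suc i \<and> J $$ (i, i) = J $$ (j, j)"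
    if "i < n" "j < n" "J $$ (i, j) \<noteq> 0" "i \<noteq> j" for i j
    using jordan_matrix_entry[of i n_as j] that unfolding J_def n by blast
  have diag: "J $$ (i, j) = 0" if "i < n" "j < n" "i \<noteq> j" for i j
  proof (rule ccontr)
    assume "J $$ (i, j) \<noteq> 0"
    then have ex: "Suc i < n \<and> J $$ (i, Suc i) \<noteq> 0"
      using entry[of i j] that by auto
    define m where "m = (LEAST i. Suc i < n \<and> J $$ (i, Suc i) \<noteq> 0)"
    have m: "Suc m < n" "J $$ (m, Suc m) \<noteq> 0"
      using LeastI[of "\<lambda>i. Suc i < n \<and> J $$ (i, Suc i) \<noteq> 0", OF ex] unfolding m_def by auto
    have min: "J $$ (k, Suc k) = 0" if "Suc k < n" "k < m" for k
      using not_less_Least[of k "\<lambda>i. Suc i < n \<and> J $$ (i, Suc i) \<noteq> 0"] that unfolding m_def by blast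
    define c where "c = J $$ (m, m)"
    have c: "J $$ (Suc m, Suc m) = c"
      using entry[of m "Suc m"] m unfolding c_def by auto
    define N where "N = J - c \<cdot>\<^sub>m 1\<^sub>m n"
    define M where "M = A - c \<cdot>\<^sub>m 1\<^sub>m n"
    have N: "N \<in> carrier_mat n n" and M: "M \<in> carrier_mat n n"
      unfolding N_def M_def using W A by auto
    have MPNQ: "M = P * N * Q"
    proof -
      have "P * N * Q = P * J * Q - P * (c \<cdot>\<^sub>m 1\<^sub>m n) * Q"
        unfolding N_def using W
        by (simp add: mult_minus_distrib_mat[of _ n n] minus_mult_distrib_mat[of _ n n])
      also have "P * (c \<cdot>\<^sub>m 1\<^sub>m n) * Q = c \<cdot>\<^sub>m (P * Q)"
        using W by (simp add: mult_smult_distrib[of _ n n] mult_smult_assoc_mat[of _ n n])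
      finally show ?thesis using W unfolding M_def by simp
    qed
    have Msym: "M\<^sup>T = M"
    proof (rule eq_matI)
      fix i j assume "i < dim_row M" "j < dim_col M"
      then have ij: "i < n" "j < n" using M by auto
      have "A $$ (j, i) = A $$ (i, j)"
        using arg_cong[OF sym, of "\<lambda>B. B $$ (i, j)"] A ij by simp
      then show "M\<^sup>T $$ (i, j) = M $$ (i, j)" unfolding M_def using A ij by auto
    qed (use M in auto)
    define e where "e = (unit_vec n (Suc m) :: real vec)"
    have e: "e \<in> carrier_vec n" unfolding e_def by simp
    have Ne: "N *\<^sub>v e = J $$ (m, Suc m) \<cdot>\<^sub>v unit_vec n m"
    proof (rule eq_vecI)
      fix k assume "k < dim_vec (J $$ (m, Suc m) \<cdot>\<^sub>v (unit_vec n m :: real vec))"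
      then have k: "k < n" by simp
      show "(N *\<^sub>v e) $ k = (J $$ (m, Suc m) \<cdot>\<^sub>v unit_vec n m) $ k"
        using entry[of k "Suc m"] k m c W(5) N unfolding e_def
        by (auto simp: mult_unit_vec[OF N] N_def)
    qed (use N e in auto)
    have Nm: "N *\<^sub>v unit_vec n m = 0\<^sub>v n"
    proof (rule eq_vecI)
      fix k assume "k < dim_vec (0\<^sub>v n :: real vec)"
      then have k: "k < n" by simp
      show "(N *\<^sub>v unit_vec n m) $ k = 0\<^sub>v n $ k"
        using entry[of k m] min[of k] k m W(5) N c_def
        by (auto simp: mult_unit_vec[OF N] N_def)
    qed (use N in auto)
    have NNe: "N *\<^sub>v (N *\<^sub>v e) = 0\<^sub>v n"
      unfolding Ne mult_mat_vec[OF N unit_vec_carrier] Nm by (rule eq_vecI) auto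
    have QP: "Q *\<^sub>v (P *\<^sub>v y) = y" if "y \<in> carrier_vec n" for y
      using W that by (simp flip: assoc_mult_mat_vec[of _ n n])
    have MP: "M *\<^sub>v (P *\<^sub>v y) = P *\<^sub>v (N *\<^sub>v y)" if "y \<in> carrier_vec n" for y
    proof -
      have Py: "P *\<^sub>v y \<in> carrier_vec n" using W that by simp
      have "(P * N * Q) *\<^sub>v (P *\<^sub>v y) = (P * N) *\<^sub>v (Q *\<^sub>v (P *\<^sub>v y))"
        by (rule assoc_mult_mat_vec[OF mult_carrier_mat[OF W(6) N] W(7) Py])
      then show ?thesis
        unfolding MPNQ QP[OF that] by (simp only: assoc_mult_mat_vec[OF W(6) N that])
    qed
    have "M *\<^sub>v (M *\<^sub>v (P *\<^sub>v e)) = 0\<^sub>v n"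
      using MP[OF e] MP[of "N *\<^sub>v e"] NNe N e mult_mat_zero_vec[OF W(6)] by simp
    then have "M *\<^sub>v (P *\<^sub>v e) = 0\<^sub>v n"
      using W e by (intro symmetric_kernel_square[OF M Msym, of "P *\<^sub>v e"]) simp_all
    then have "N *\<^sub>v e = 0\<^sub>v n"
      using MP[OF e] QP[of "N *\<^sub>v e"] N e mult_mat_zero_vec[OF W(7)] by simp
    then have "(J $$ (m, Suc m) \<cdot>\<^sub>v unit_vec n m) $ m = (0\<^sub>v n :: real vec) $ m"
      using Ne by simp
    then show False using m by simp
  qed
  have "J = mat_diag n (\<lambda>i. J $$ (i, i))"
    by (rule eq_matI) (use W(5) diag in \<open>auto simp: mat_diag_def\<close>)
  then show ?thesis using W by metis
qed

text \<open>
  The columns of \<open>P\<close> need not be orthogonal, so the symmetry of a function of a symmetric matrix requires an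
  argument. Symmetry of \<open>P D Q\<close> says that the Gram matrix \<open>G = P\<^sup>T P\<close> commutes with the diagonal
  matrix \<open>D\<close>; hence \<open>G\<close> has an entry at \<open>(i, j)\<close> only where \<open>d i = d j\<close>, and so it
  also commutes with every diagonal matrix that is a function of \<open>D\<close>.
\<close>

lemma symmetric_mat_fun_calculus:
  fixes P :: "real mat"
  assumes P: "P \<in> carrier_mat n n" and Q: "Q \<in> carrier_mat n n"
    and PQ: "P * Q = 1\<^sub>m n" and QP: "Q * P = 1\<^sub>m n"
    and sym: "(P * mat_diag n d * Q)\<^sup>T = P * mat_diag n d * Q"
  shows "(P * mat_diag n (\<lambda>i. f (d i)) * Q)\<^sup>T = P * mat_diag n (\<lambda>i. f (d i)) * Q"
proof -
  note [simp] = assoc_mult_mat[of _ n n _ n _ n]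
  define D where "D = mat_diag n d"
  define F where "F = mat_diag n (\<lambda>i. f (d i))"
  define G where "G = P\<^sup>T * P"
  have D: "D \<in> carrier_mat n n" "D\<^sup>T = D" and F: "F \<in> carrier_mat n n" "F\<^sup>T = F"
    unfolding D_def F_def by (auto simp: mat_diag_def intro!: eq_matI)
  have G: "G \<in> carrier_mat n n" using P unfolding G_def by simp
  have PT: "P\<^sup>T \<in> carrier_mat n n" "Q\<^sup>T \<in> carrier_mat n n" using P Q by auto
  have PQT: "P\<^sup>T * Q\<^sup>T = 1\<^sub>m n" "Q\<^sup>T * P\<^sup>T = 1\<^sub>m n"
    using arg_cong[OF QP, of transpose_mat] arg_cong[OF PQ, of transpose_mat]
      transpose_mult[OF Q P] transpose_mult[OF P Q] by auto
  have tr: "(P * X * Q)\<^sup>T = Q\<^sup>T * X * P\<^sup>T" if "X \<in> carrier_mat n n" "X\<^sup>T = X" for X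
    using that P Q PT by (simp add: transpose_mult[of _ n n _ n])
  have cancel: "P\<^sup>T * (Q\<^sup>T * X) = X" "Q\<^sup>T * (P\<^sup>T * X) = X" "Q * (P * X) = X" "P * (Q * X) = X"
    if "X \<in> carrier_mat n n" for X
    using that P Q PT PQT PQ QP by (simp_all flip: assoc_mult_mat[of _ n n _ n _ n])
  have "Q\<^sup>T * D * P\<^sup>T = P * D * Q" using sym tr[OF D] unfolding D_def by simp
  then have "P\<^sup>T * (Q\<^sup>T * D * P\<^sup>T) * P = P\<^sup>T * (P * D * Q) * P" by simp
  then have GD: "D * G = G * D"
    unfolding G_def using P Q PT D cancel QP by simp
  have "F * G = G * F"
  proof (rule eq_matI)
    fix i j assume "i < dim_row (G * F)" "j < dim_col (G * F)"
    then have ij: "i < n" "j < n" using G F by auto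
    have "d i * G $$ (i, j) = G $$ (i, j) * d j"
      using arg_cong[OF GD, of "\<lambda>M. M $$ (i, j)"] ij
      unfolding D_def mat_diag_mult_left[OF G] mat_diag_mult_right[OF G] by simp
    then show "(F * G) $$ (i, j) = (G * F) $$ (i, j)"
      using ij unfolding F_def mat_diag_mult_left[OF G] mat_diag_mult_right[OF G] by auto
  qed (use F G in auto)
  then have "Q\<^sup>T * (F * G) * Q = Q\<^sup>T * (G * F) * Q" by simp
  then have "Q\<^sup>T * F * P\<^sup>T = P * F * Q"
    unfolding G_def using P Q PT F cancel PQ by simp
  then show ?thesis using tr[OF F] unfolding F_def by simp
qed

section \<open>Positive semidefinite square roots and absolute values\<close>

lemma psd_diagonalizable:
  fixes A :: "real mat"
  assumes A: "A \<in> carrier_mat n n" and psd: "positive_semidefinite A"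
  obtains P Q d where "P \<in> carrier_mat n n" "Q \<in> carrier_mat n n" "P * Q = 1\<^sub>m n" "Q * P = 1\<^sub>m n"
    "A = P * mat_diag n d * Q" "\<And>i. i < n \<Longrightarrow> 0 \<le> d i"
    "\<And>i. i < n \<Longrightarrow> A *\<^sub>v (P *\<^sub>v unit_vec n i) = d i \<cdot>\<^sub>v (P *\<^sub>v unit_vec n i)"
proof -
  have sym: "A\<^sup>T = A" and nonneg: "\<And>x. x \<in> carrier_vec n \<Longrightarrow> 0 \<le> (A *\<^sub>v x) \<bullet> x"
    using psd positive_semidefinite_real_iff[OF A] by auto
  obtain P Q d where P: "P \<in> carrier_mat n n" and Q: "Q \<in> carrier_mat n n"
    and PQ: "P * Q = 1\<^sub>m n" "Q * P = 1\<^sub>m n" and eq: "A = P * mat_diag n d * Q"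
    using symmetric_diagonalizable[OF A sym] by blast
  have QP: "Q *\<^sub>v (P *\<^sub>v y) = y" if "y \<in> carrier_vec n" for y
    using P Q PQ that by (simp flip: assoc_mult_mat_vec[of _ n n])
  have ev: "A *\<^sub>v (P *\<^sub>v unit_vec n i) = d i \<cdot>\<^sub>v (P *\<^sub>v unit_vec n i)" if i: "i < n" for i
  proof -
    have "mat_diag n d *\<^sub>v unit_vec n i = d i \<cdot>\<^sub>v unit_vec n i"
      by (rule eq_vecI) (use i in \<open>auto simp: mult_unit_vec[of _ n n] mat_diag_def\<close>)
    then show ?thesis
      unfolding eq using P Q QP[of "unit_vec n i"]
      by (simp add: assoc_mult_mat_vec[of _ n n _ n] mult_mat_vec[OF P])
  qed
  have "0 \<le> d i" if i: "i < n" for i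
  proof -
    define x where "x = P *\<^sub>v unit_vec n i"
    have x: "x \<in> carrier_vec n" unfolding x_def using P by simp
    have "x \<noteq> 0\<^sub>v n"
    proof
      assume "x = 0\<^sub>v n"
      then have "unit_vec n i = (0\<^sub>v n :: real vec)"
        using QP[of "unit_vec n i"] mult_mat_zero_vec[OF Q] unfolding x_def by simp
      then show False using i by simp
    qed
    then have "0 < x \<bullet> x"
      using square_norm_nonneg[of x] square_norm_eq_0_iff[OF x] by linarith
    moreover have "0 \<le> d i * (x \<bullet> x)"
      using nonneg[OF x] ev[OF i] x unfolding x_def[symmetric] by simp
    ultimately show ?thesis by (simp add: zero_le_mult_iff)
  qed
  with that P Q PQ eq ev show thesis by blast
qed

lemma psd_mult_transpose:
  fixes R :: "real mat"
  assumes R: "R \<in> carrier_mat n m"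
  shows "positive_semidefinite (R * R\<^sup>T)"
proof -
  have S: "R * R\<^sup>T \<in> carrier_mat n n" using R by simp
  have "0 \<le> ((R * R\<^sup>T) *\<^sub>v x) \<bullet> x" if x: "x \<in> carrier_vec n" for x
  proof -
    have "((R * R\<^sup>T) *\<^sub>v x) \<bullet> x = (R *\<^sub>v (R\<^sup>T *\<^sub>v x)) \<bullet> x"
      using R x by (simp add: assoc_mult_mat_vec[of _ n m _ n])
    also have "\<dots> = (R\<^sup>T *\<^sub>v x) \<bullet> (R\<^sup>T *\<^sub>v x)"
      using transpose_vec_mult_scalar[of "R\<^sup>T" m n x "R\<^sup>T *\<^sub>v x"] R x by simp
    finally show ?thesis using square_norm_nonneg by simp
  qed
  then show ?thesis
    using positive_semidefinite_real_iff[OF S] R by (simp add: transpose_mult[of R n m _ n])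
qed

text \<open>
  The root is built as the square of the symmetric matrix \<open>C\<close> with the fourth roots of the
  eigenvalues, because then positive semidefiniteness needs no orthogonality of the eigenvectors.
\<close>

lemma psd_sqrt_exists:
  fixes A :: "real mat"
  assumes A: "A \<in> carrier_mat n n" and psd: "positive_semidefinite A"
  shows "\<exists>B \<in> carrier_mat n n. positive_semidefinite B \<and> B * B = A"
proof -
  note [simp] = assoc_mult_mat[of _ n n _ n _ n]
  obtain P Q d where P: "P \<in> carrier_mat n n" and Q: "Q \<in> carrier_mat n n"
    and PQ: "P * Q = 1\<^sub>m n" "Q * P = 1\<^sub>m n" and eq: "A = P * mat_diag n d * Q"
    and d: "\<And>i. i < n \<Longrightarrow> 0 \<le> d i"
    using psd_diagonalizable[OF A psd] by metis
  have mult: "(P * mat_diag n f * Q) * (P * mat_diag n g * Q) = P * mat_diag n (\<lambda>i. f i * g i) * Q" for f g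
  proof -
    have X: "(P * X * Q) * (P * Y * Q) = P * (X * Y) * Q"
      if "X \<in> carrier_mat n n" "Y \<in> carrier_mat n n" for X Y
    proof -
      have "Q * (P * (Y * Q)) = Y * Q"
        unfolding assoc_mult_mat[OF Q P mult_carrier_mat[OF that(2) Q], symmetric] PQ(2)
        by (rule left_mult_one_mat[OF mult_carrier_mat[OF that(2) Q]])
      then show ?thesis using P Q that by simp
    qed
    show ?thesis by (simp only: X[OF mat_diag_dim mat_diag_dim] mat_diag_diag)
  qed
  define C where "C = P * mat_diag n (\<lambda>i. sqrt (sqrt (d i))) * Q"
  have C: "C \<in> carrier_mat n n"
    unfolding C_def by (intro mult_carrier_mat[OF mult_carrier_mat[OF P mat_diag_dim] Q])
  have Csym: "C\<^sup>T = C"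
    using symmetric_mat_fun_calculus[OF P Q PQ, of d "\<lambda>t. sqrt (sqrt t)"] psd eq
      positive_semidefinite_real_iff[OF A] unfolding C_def by auto
  have "positive_semidefinite (C * C)"
    using psd_mult_transpose[OF C] Csym by simp
  moreover have "(C * C) * (C * C) = A"
  proof -
    have "(C * C) * (C * C) = P * mat_diag n (\<lambda>i. (sqrt (sqrt (d i)) * sqrt (sqrt (d i))) *
        (sqrt (sqrt (d i)) * sqrt (sqrt (d i)))) * Q"
      unfolding C_def mult ..
    also have "mat_diag n (\<lambda>i. (sqrt (sqrt (d i)) * sqrt (sqrt (d i))) *
        (sqrt (sqrt (d i)) * sqrt (sqrt (d i)))) = mat_diag n d"
      by (rule eq_matI) (use d in \<open>auto simp: mat_diag_def\<close>)
    finally show ?thesis using eq by simp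
  qed
  ultimately show ?thesis using C by (intro bexI[of _ "C * C"]) auto
qed

text \<open>
  The vector \<open>w = C x - b x\<close> satisfies \<open>C w = - b w\<close>, which for \<open>b > 0\<close> contradicts positive
  semidefiniteness unless \<open>w = 0\<close>. For \<open>b = 0\<close> it is a case of \<open>symmetric_kernel_square\<close>.
\<close>

lemma psd_eigenvector_of_square:
  fixes C :: "real mat"
  assumes C: "C \<in> carrier_mat n n" and psd: "positive_semidefinite C" and x: "x \<in> carrier_vec n"
    and b: "0 \<le> b" and eq: "C *\<^sub>v (C *\<^sub>v x) = (b * b) \<cdot>\<^sub>v x"
  shows "C *\<^sub>v x = b \<cdot>\<^sub>v x"
proof (cases "b = 0")
  case True
  have "C *\<^sub>v x = 0\<^sub>v n"
  proof (rule symmetric_kernel_square[OF C _ x])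
    show "C\<^sup>T = C" using psd positive_semidefinite_real_iff[OF C] by blast
    show "C *\<^sub>v (C *\<^sub>v x) = 0\<^sub>v n" using eq True x by auto
  qed
  then show ?thesis using True x by auto
next
  case False
  define w where "w = C *\<^sub>v x - b \<cdot>\<^sub>v x"
  have w: "w \<in> carrier_vec n" unfolding w_def using C x by simp
  have Cw: "C *\<^sub>v w = (- b) \<cdot>\<^sub>v w"
  proof -
    have "C *\<^sub>v w = (b * b) \<cdot>\<^sub>v x - b \<cdot>\<^sub>v (C *\<^sub>v x)"
      unfolding w_def using C x eq
      by (simp add: mult_minus_distrib_mat_vec[OF C] mult_mat_vec[OF C])
    also have "\<dots> = (- b) \<cdot>\<^sub>v w"
      unfolding w_def by (rule eq_vecI) (use C x in \<open>auto simp: algebra_simps\<close>)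
    finally show ?thesis .
  qed
  have "0 \<le> (- b) * (w \<bullet> w)"
    using psd positive_semidefinite_real_iff[OF C] w Cw by (metis smult_scalar_prod_distrib)
  then have "w \<bullet> w = 0"
    using square_norm_nonneg[of w] b False by (simp add: mult_le_0_iff)
  then have "w = 0\<^sub>v n" using square_norm_eq_0_iff[OF w] by simp
  then have *: "w $ i = 0" if "i < n" for i using that by simp
  show ?thesis
  proof (rule eq_vecI)
    fix i assume "i < dim_vec (b \<cdot>\<^sub>v x)"
    then show "(C *\<^sub>v x) $ i = (b \<cdot>\<^sub>v x) $ i"
      using *[of i] C x unfolding w_def by (simp del: index_mult_mat_vec)
  qed (use C x in auto)
qed

text \<open>
  Each eigenvector of \<open>B\<close> is an eigenvector of \<open>C\<^sup>2 = B\<^sup>2\<close>, hence of \<open>C\<close> with the same eigenvalue; and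
  the eigenvectors of \<open>B\<close> form a basis.
\<close>

lemma psd_square_inj:
  fixes B C :: "real mat"
  assumes B: "B \<in> carrier_mat n n" "positive_semidefinite B"
    and C: "C \<in> carrier_mat n n" "positive_semidefinite C" and eq: "B * B = C * C"
  shows "B = C"
proof -
  note [simp] = assoc_mult_mat[of _ n n _ n _ n]
  obtain P Q b where P: "P \<in> carrier_mat n n" and Q: "Q \<in> carrier_mat n n"
    and PQ: "P * Q = 1\<^sub>m n" and b: "\<And>i. i < n \<Longrightarrow> 0 \<le> b i"
    and ev: "\<And>i. i < n \<Longrightarrow> B *\<^sub>v (P *\<^sub>v unit_vec n i) = b i \<cdot>\<^sub>v (P *\<^sub>v unit_vec n i)"
    using psd_diagonalizable[OF B] by metis
  have "B * P = C * P"
  proof (rule eq_mat_by_mult_vec[of _ n n])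
    fix i assume i: "i < n"
    define x where "x = P *\<^sub>v unit_vec n i"
    have x: "x \<in> carrier_vec n" unfolding x_def using P by simp
    have Bx: "B *\<^sub>v x = b i \<cdot>\<^sub>v x" using ev[OF i] unfolding x_def .
    have "C *\<^sub>v (C *\<^sub>v x) = B *\<^sub>v (B *\<^sub>v x)"
      using eq B(1) C(1) x by (metis assoc_mult_mat_vec)
    also have "\<dots> = (b i * b i) \<cdot>\<^sub>v x"
      using Bx B(1) x by (simp add: mult_mat_vec[OF B(1)] smult_smult_assoc)
    finally have "C *\<^sub>v x = b i \<cdot>\<^sub>v x"
      by (rule psd_eigenvector_of_square[OF C x b[OF i]])
    then show "(B * P) *\<^sub>v unit_vec n i = (C * P) *\<^sub>v unit_vec n i"
      using Bx B(1) C(1) P unfolding x_def by (simp add: assoc_mult_mat_vec[of _ n n _ n])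
  qed (use B C P in auto)
  then have "B * P * Q = C * P * Q" by simp
  then show ?thesis using B C P Q PQ by simp
qed

lemma psd_sqrt_eqI:
  fixes B :: "real mat"
  assumes B: "B \<in> carrier_mat n n" and psd: "positive_semidefinite B" and eq: "B * B = A"
  shows "psd_sqrt A = B"
  unfolding psd_sqrt_def
proof (rule the_equality)
  fix C assume C: "positive_semidefinite C \<and> C * C = A"
  have "dim_row C = n" using C eq B by (metis carrier_matD(1) index_mult_mat(2))
  then have "C \<in> carrier_mat n n" using C unfolding positive_semidefinite_def by auto
  then show "C = B" using C eq by (intro psd_square_inj[OF _ _ B psd]) simp_all
qed (use psd eq in auto)

lemma mat_abs_psd:
  fixes R :: "real mat"
  assumes R: "R \<in> carrier_mat n m"
  shows "mat_abs R \<in> carrier_mat n n" "positive_semidefinite (mat_abs R)"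
    "mat_abs R * mat_abs R = R * R\<^sup>T"
proof -
  have S: "R * R\<^sup>T \<in> carrier_mat n n" using R by simp
  obtain B where B: "B \<in> carrier_mat n n" "positive_semidefinite B" "B * B = R * R\<^sup>T"
    using psd_sqrt_exists[OF S psd_mult_transpose[OF R]] by blast
  then have "mat_abs R = B"
    unfolding mat_abs_def mat_adjoint_real by (intro psd_sqrt_eqI)
  then show "mat_abs R \<in> carrier_mat n n" "positive_semidefinite (mat_abs R)"
    "mat_abs R * mat_abs R = R * R\<^sup>T" using B by auto
qed

text \<open>
  With \<open>y = B x\<close>, expanding \<open>0 \<le> B (x - y) \<bullet> (x - y)\<close> gives \<open>2 (y \<bullet> y) \<le> y \<bullet> x + (B y) \<bullet> y\<close>, and
  \<open>(B y) \<bullet> y \<le> y \<bullet> y\<close> because the squared norm of \<open>y - B y\<close> is at most \<open>2 (y \<bullet> y) - 2 ((B y) \<bullet> y)\<close>.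
  If equality holds in the result, that squared norm vanishes.
\<close>

lemma psd_contraction:
  fixes B :: "real mat"
  assumes B: "B \<in> carrier_mat n n" and psd: "positive_semidefinite B"
    and contr: "\<And>x. x \<in> carrier_vec n \<Longrightarrow> (B *\<^sub>v x) \<bullet> (B *\<^sub>v x) \<le> x \<bullet> x"
    and x: "x \<in> carrier_vec n"
  shows "(B *\<^sub>v x) \<bullet> (B *\<^sub>v x) \<le> (B *\<^sub>v x) \<bullet> x"
    and "(B *\<^sub>v x) \<bullet> (B *\<^sub>v x) = (B *\<^sub>v x) \<bullet> x \<Longrightarrow> B *\<^sub>v (B *\<^sub>v x) = B *\<^sub>v x"
proof -
  define y where "y = B *\<^sub>v x"
  have y: "y \<in> carrier_vec n" and By: "B *\<^sub>v y \<in> carrier_vec n"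
    unfolding y_def using B x by auto
  have sym: "B\<^sup>T = B" and nonneg: "\<And>x. x \<in> carrier_vec n \<Longrightarrow> 0 \<le> (B *\<^sub>v x) \<bullet> x"
    using psd positive_semidefinite_real_iff[OF B] by auto
  have Byx: "(B *\<^sub>v y) \<bullet> x = y \<bullet> y"
    using symmetric_mat_scalar_prod[OF B sym y x] unfolding y_def .
  have "0 \<le> (B *\<^sub>v (x - y)) \<bullet> (x - y)" using nonneg x y by simp
  also have "B *\<^sub>v (x - y) = y - B *\<^sub>v y"
    unfolding y_def using B x by (simp add: mult_minus_distrib_mat_vec[OF B])
  also have "(y - B *\<^sub>v y) \<bullet> (x - y) = y \<bullet> x - 2 * (y \<bullet> y) + (B *\<^sub>v y) \<bullet> y"
    using x y By Byx
    by (simp add: minus_scalar_prod_distrib[of _ n] scalar_prod_minus_distrib[of _ n])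
  finally have 1: "2 * (y \<bullet> y) \<le> y \<bullet> x + (B *\<^sub>v y) \<bullet> y" by simp
  have 2: "(y - B *\<^sub>v y) \<bullet> (y - B *\<^sub>v y) = y \<bullet> y - 2 * ((B *\<^sub>v y) \<bullet> y) + (B *\<^sub>v y) \<bullet> (B *\<^sub>v y)"
    using y By comm_scalar_prod[OF y By]
    by (simp add: minus_scalar_prod_distrib[of _ n] scalar_prod_minus_distrib[of _ n])
  have 3: "(B *\<^sub>v y) \<bullet> (B *\<^sub>v y) \<le> y \<bullet> y" by (rule contr[OF y])
  have 4: "0 \<le> (y - B *\<^sub>v y) \<bullet> (y - B *\<^sub>v y)" by (rule square_norm_nonneg)
  show "(B *\<^sub>v x) \<bullet> (B *\<^sub>v x) \<le> (B *\<^sub>v x) \<bullet> x"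
    using 1 2 3 4 unfolding y_def[symmetric] by linarith
  assume "(B *\<^sub>v x) \<bullet> (B *\<^sub>v x) = (B *\<^sub>v x) \<bullet> x"
  then have "(y - B *\<^sub>v y) \<bullet> (y - B *\<^sub>v y) = 0"
    using 1 2 3 4 unfolding y_def[symmetric] by linarith
  then have "y - B *\<^sub>v y = 0\<^sub>v n" using square_norm_eq_0_iff[of "y - B *\<^sub>v y" n] y By by simp
  then have *: "y $ i - (B *\<^sub>v y) $ i = 0" if "i < n" for i
    using that By by (metis index_minus_vec(1) index_zero_vec(1) carrier_vecD)
  show "B *\<^sub>v (B *\<^sub>v x) = B *\<^sub>v x"
    unfolding y_def[symmetric] by (rule eq_vecI) (use * y B in auto)
qed

lemma mat_diag_entry_scalar_prod:
  assumes "(A :: real mat) \<in> carrier_mat n n" "i < n"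
  shows "(A *\<^sub>v unit_vec n i) \<bullet> unit_vec n i = A $$ (i, i)"
  using assms by (simp add: mult_unit_vec)

lemma symmetric_square_entry:
  assumes A: "(A :: real mat) \<in> carrier_mat n n" and sym: "A\<^sup>T = A" and i: "i < n"
  shows "(A *\<^sub>v unit_vec n i) \<bullet> (A *\<^sub>v unit_vec n i) = (A * A) $$ (i, i)"
proof -
  have "(A *\<^sub>v unit_vec n i) \<bullet> (A *\<^sub>v unit_vec n i) = ((A * A) *\<^sub>v unit_vec n i) \<bullet> unit_vec n i"
    using symmetric_mat_scalar_prod[OF A sym, of "A *\<^sub>v unit_vec n i" "unit_vec n i"] A
    by (simp add: assoc_mult_mat_vec[of _ n n _ n])
  then show ?thesis using mat_diag_entry_scalar_prod[of "A * A" n i] A i by simp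
qed

text \<open>
  Since \<open>|R|\<close> and \<open>R\<close> have the same square, \<open>|R| x\<close> and \<open>R x\<close> have the same norm, so \<open>|R|\<close> is a
  contraction too and \<open>psd_contraction\<close> applies to the unit vectors. In the case of equality it makes
  \<open>|R|\<close> idempotent. In the other direction \<open>R\<^sup>3 = R\<close> makes \<open>R\<^sup>2\<close> its own positive
  semidefinite square root, so that \<open>|R| = R\<^sup>2\<close>.
\<close>

lemma mat_abs_contraction:
  fixes R :: "real mat"
  assumes R: "R \<in> carrier_mat n n" and sym: "R\<^sup>T = R"
    and contr: "\<And>x. x \<in> carrier_vec n \<Longrightarrow> (R *\<^sub>v x) \<bullet> (R *\<^sub>v x) \<le> x \<bullet> x"
  shows mat_abs_diag_ge_square: "\<And>i. i < n \<Longrightarrow> (R * R) $$ (i, i) \<le> mat_abs R $$ (i, i)"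
    and mat_abs_diag_eq_square_iff:
      "(\<forall>i<n. mat_abs R $$ (i, i) = (R * R) $$ (i, i)) \<longleftrightarrow> R * R * R = R"
proof -
  note [simp] = assoc_mult_mat[of _ n n _ n _ n] assoc_mult_mat_vec[of _ n n _ n]
  define B where "B = mat_abs R"
  have B: "B \<in> carrier_mat n n" and psd: "positive_semidefinite B" and BB: "B * B = R * R"
    using mat_abs_psd[OF R] sym unfolding B_def by auto
  have Bsym: "B\<^sup>T = B" using psd positive_semidefinite_real_iff[OF B] by auto
  have Bcontr: "(B *\<^sub>v x) \<bullet> (B *\<^sub>v x) \<le> x \<bullet> x" if x: "x \<in> carrier_vec n" for x
  proof -
    have "(B *\<^sub>v x) \<bullet> (B *\<^sub>v x) = x \<bullet> ((B * B) *\<^sub>v x)"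
      using symmetric_mat_scalar_prod[OF B Bsym x, of "B *\<^sub>v x"] B x by simp
    also have "\<dots> = (R *\<^sub>v x) \<bullet> (R *\<^sub>v x)"
      unfolding BB using symmetric_mat_scalar_prod[OF R sym x, of "R *\<^sub>v x"] R x by simp
    finally show ?thesis using contr[OF x] by simp
  qed
  have entries: "(B *\<^sub>v unit_vec n i) \<bullet> (B *\<^sub>v unit_vec n i) = (R * R) $$ (i, i)"
    "(B *\<^sub>v unit_vec n i) \<bullet> unit_vec n i = mat_abs R $$ (i, i)" if "i < n" for i
    using symmetric_square_entry[OF B Bsym that] mat_diag_entry_scalar_prod[OF B that] BB
    unfolding B_def by auto
  show "(R * R) $$ (i, i) \<le> mat_abs R $$ (i, i)" if "i < n" for i
    using psd_contraction(1)[OF B psd Bcontr, of "unit_vec n i"] entries[OF that] by simp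
  show "(\<forall>i<n. mat_abs R $$ (i, i) = (R * R) $$ (i, i)) \<longleftrightarrow> R * R * R = R"
  proof
    assume eq: "\<forall>i<n. mat_abs R $$ (i, i) = (R * R) $$ (i, i)"
    have "B * B = B"
    proof (rule eq_mat_by_mult_vec[of _ n n])
      fix i assume "i < n"
      then show "(B * B) *\<^sub>v unit_vec n i = B *\<^sub>v unit_vec n i"
        using psd_contraction(2)[OF B psd Bcontr, of "unit_vec n i"] entries[of i] eq B by simp
    qed (use B in auto)
    then have idem: "(R * R) * (R * R) = R * R" using BB by simp
    show "R * R * R = R"
    proof (rule eq_mat_by_mult_vec[of _ n n])
      fix i assume "i < n"
      define x where "x = (unit_vec n i :: real vec)"
      have x: "x \<in> carrier_vec n" unfolding x_def by simp
      \<comment> \<open>\<open>R\<^sup>4 = R\<^sup>2\<close> says \<open>R (R v) = 0\<close>, and \<open>R v = 0\<close> is the equation \<open>R\<^sup>3 x = R x\<close>\<close>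
      define v where "v = R *\<^sub>v (R *\<^sub>v x) - x"
      have v: "v \<in> carrier_vec n" unfolding v_def using R x by simp
      have "R *\<^sub>v (R *\<^sub>v v) = ((R * R) * (R * R)) *\<^sub>v x - (R * R) *\<^sub>v x"
        unfolding v_def using R x by (simp add: mult_minus_distrib_mat_vec[OF R])
      also have "\<dots> = 0\<^sub>v n" unfolding idem using R x by simp
      finally have "R *\<^sub>v v = 0\<^sub>v n" by (rule symmetric_kernel_square[OF R sym v])
      then have "(R * R * R) *\<^sub>v x - R *\<^sub>v x = 0\<^sub>v n"
        unfolding v_def using R x by (simp add: mult_minus_distrib_mat_vec[OF R])
      then have *: "((R * R * R) *\<^sub>v x) $ i - (R *\<^sub>v x) $ i = 0" if "i < n" for i
        using that R by (metis carrier_matD(1) dim_mult_mat_vec index_minus_vec(1) index_zero_vec(1))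
      have "(R * R * R) *\<^sub>v x = R *\<^sub>v x"
        by (rule eq_vecI) (use * R in \<open>auto simp del: index_mult_mat_vec\<close>)
      then show "(R * R * R) *\<^sub>v unit_vec n i = R *\<^sub>v unit_vec n i" unfolding x_def .
    qed (use R in auto)
  next
    assume cube: "R * R * R = R"
    have "(R * R) * (R * R) = R * (R * R * R)" using R by simp
    then have "(R * R) * (R * R) = R * R" unfolding cube .
    moreover have "positive_semidefinite (R * R)"
      using psd_mult_transpose[OF R] sym by simp
    ultimately have "mat_abs R = R * R"
      unfolding mat_abs_def mat_adjoint_real using R sym by (intro psd_sqrt_eqI[of _ n]) auto
    then show "\<forall>i<n. mat_abs R $$ (i, i) = (R * R) $$ (i, i)" by simp
  qed
qed

section \<open>Degree-normalised adjacency matrices\<close>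

text \<open>
  The Randic matrix in terms of indices: a relation on \<open>{..<n}\<close> takes the place of the graph, and the
  degrees are counted from the relation itself.
\<close>

definition normalized_adjacency :: "nat \<Rightarrow> (nat \<Rightarrow> nat \<Rightarrow> bool) \<Rightarrow> real mat" where
  "normalized_adjacency n E = mat n n (\<lambda>(i, j). if E i j
     then 1 / sqrt (real (card {k. k < n \<and> E i k}) * real (card {k. k < n \<and> E j k})) else 0)"

context
  fixes n :: nat and E :: "nat \<Rightarrow> nat \<Rightarrow> bool"
  assumes E_sym: "E i j \<Longrightarrow> E j i"
begin

private definition N where "N i = {k. k < n \<and> E i k}"
private definition d where "d i = real (card (N i))"
private abbreviation R where "R \<equiv> normalized_adjacency n E"

private lemma finite_N [simp]: "finite (N i)"
  unfolding N_def by simp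

private lemma N_sym: "i < n \<Longrightarrow> j \<in> N i \<Longrightarrow> i \<in> N j"
  unfolding N_def using E_sym by auto

private lemma d_pos: "j \<in> N i \<Longrightarrow> 0 < d i"
  unfolding d_def by (auto simp: card_gt_0_iff)

private lemma R_carrier [simp]: "R \<in> carrier_mat n n" "dim_row R = n" "dim_col R = n"
  unfolding normalized_adjacency_def by auto

private lemma R_entry: "i < n \<Longrightarrow> j < n \<Longrightarrow> R $$ (i, j) = (if j \<in> N i then 1 / sqrt (d i * d j) else 0)"
  unfolding normalized_adjacency_def d_def N_def by auto

lemma normalized_adjacency_symmetric: "R\<^sup>T = R"
  by (rule eq_matI) (auto simp: R_entry mult.commute dest: N_sym)

private lemma sum_N: "(\<Sum>j<n. if j \<in> N i then f j else 0) = sum f (N i)" for f :: "nat \<Rightarrow> real"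
proof -
  have "{..<n} \<inter> {j. j \<in> N i} = N i" unfolding N_def by auto
  then show ?thesis by (simp add: sum.If_cases)
qed

text \<open>
  With \<open>y\<^sub>j = x\<^sub>j / sqrt (d j)\<close> the entry \<open>(R x)\<^sub>i\<close> is the sum of \<open>y\<close> over the \<open>d i\<close> neighbours of \<open>i\<close>, divided
  by \<open>sqrt (d i)\<close>. By Cauchy-Schwarz its square is at most the sum of the \<open>y\<^sub>j\<^sup>2\<close> over those neighbours.
  In the total over \<open>i\<close> the term \<open>y\<^sub>j\<^sup>2\<close> occurs \<open>d j\<close> times and so contributes at most \<open>x\<^sub>j\<^sup>2\<close>.
\<close>

lemma normalized_adjacency_contraction:
  assumes x: "x \<in> carrier_vec n"
  shows "(R *\<^sub>v x) \<bullet> (R *\<^sub>v x) \<le> x \<bullet> x"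
proof -
  have row: "((R *\<^sub>v x) $ i)\<^sup>2 \<le> (\<Sum>j<n. if j \<in> N i then (x $ j)\<^sup>2 / d j else 0)" if i: "i < n" for i
  proof -
    have "(R *\<^sub>v x) $ i = (\<Sum>j<n. if j \<in> N i then x $ j / sqrt (d j) / sqrt (d i) else 0)"
      using i x by (auto simp: scalar_prod_def R_entry real_sqrt_mult atLeast0LessThan intro!: sum.cong)
    also have "\<dots> = (\<Sum>j\<in>N i. x $ j / sqrt (d j)) / sqrt (d i)"
      by (simp add: sum_N sum_divide_distrib)
    finally have "((R *\<^sub>v x) $ i)\<^sup>2 = (\<Sum>j\<in>N i. x $ j / sqrt (d j))\<^sup>2 / d i"
      by (simp add: power_divide d_def)
    also have "\<dots> \<le> (\<Sum>j\<in>N i. (x $ j / sqrt (d j))\<^sup>2)"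
    proof (cases "N i = {}")
      case False
      then have "0 < d i" using d_pos by blast
      then show ?thesis
        using sum_squared_le_sum_of_squares[of "\<lambda>j. x $ j / sqrt (d j)" "N i"]
        by (simp add: pos_divide_le_eq d_def)
    qed simp
    also have "\<dots> = (\<Sum>j\<in>N i. (x $ j)\<^sup>2 / d j)"
      by (simp add: power_divide d_def)
    finally show ?thesis by (simp add: sum_N)
  qed
  have "(R *\<^sub>v x) \<bullet> (R *\<^sub>v x) = (\<Sum>i<n. ((R *\<^sub>v x) $ i)\<^sup>2)"
    by (simp add: scalar_prod_def power2_eq_square atLeast0LessThan del: index_mult_mat_vec)
  also have "\<dots> \<le> (\<Sum>i<n. \<Sum>j<n. if j \<in> N i then (x $ j)\<^sup>2 / d j else 0)"
    by (intro sum_mono row) auto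
  also have "\<dots> = (\<Sum>j<n. \<Sum>i<n. if j \<in> N i then (x $ j)\<^sup>2 / d j else 0)"
    by (rule sum.swap)
  also have "\<dots> = (\<Sum>j<n. \<Sum>i<n. if i \<in> N j then (x $ j)\<^sup>2 / d j else 0)"
    by (intro sum.cong refl if_cong) (auto dest: N_sym)
  also have "\<dots> = (\<Sum>j<n. d j * ((x $ j)\<^sup>2 / d j))"
    unfolding sum_N by (simp add: d_def)
  also have "\<dots> \<le> (\<Sum>j<n. (x $ j)\<^sup>2)"
    by (intro sum_mono) auto
  also have "\<dots> = x \<bullet> x"
    using x by (simp add: scalar_prod_def power2_eq_square atLeast0LessThan)
  finally show ?thesis .
qed

lemma normalized_adjacency_square_diag:
  assumes i: "i < n"
  shows "(R * R) $$ (i, i) = 1 / real (card {k. k < n \<and> E i k}) *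
    (\<Sum>j | j < n \<and> E j i. 1 / real (card {k. k < n \<and> E j k}))"
proof -
  have "(R * R) $$ (i, i) = (\<Sum>j<n. R $$ (i, j) * R $$ (j, i))"
    using i by (simp add: scalar_prod_def atLeast0LessThan)
  also have "\<dots> = (\<Sum>j<n. if j \<in> N i then 1 / d i * (1 / d j) else 0)"
  proof (intro sum.cong refl)
    fix j assume "j \<in> {..<n}"
    moreover have "sqrt (d i * d j) * sqrt (d j * d i) = d i * d j"
      by (simp add: d_def mult.commute)
    ultimately show "R $$ (i, j) * R $$ (j, i) = (if j \<in> N i then 1 / d i * (1 / d j) else 0)"
      using i N_sym[of i j] N_sym[of j i] by (auto simp: R_entry)
  qed
  also have "\<dots> = 1 / d i * (\<Sum>j\<in>N i. 1 / d j)"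
    by (simp add: sum_N sum_distrib_left)
  also have "N i = {j. j < n \<and> E j i}" unfolding N_def using E_sym by blast
  finally show ?thesis unfolding d_def N_def .
qed

private lemma R_cube_entry:
  assumes "i < n" "l < n"
  shows "(R * R * R) $$ (i, l) = (\<Sum>k<n. \<Sum>j<n. R $$ (i, j) * R $$ (j, k) * R $$ (k, l))"
  using assms by (simp add: scalar_prod_def atLeast0LessThan sum_distrib_right)

text \<open>
  A walk \<open>i, j, k, l\<close> makes a positive contribution to the entry \<open>(R\<^sup>3)\<^sub>i\<^sub>l\<close>, all of whose terms are
  nonnegative; if \<open>R\<^sup>3 = R\<close>, then \<open>i\<close> and \<open>l\<close> are adjacent. Conversely, let \<open>i\<close> and \<open>l\<close> be adjacent
  in a relation closed under such walks. Then every neighbour of \<open>i\<close> has the neighbourhood of \<open>l\<close>,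
  every neighbour of \<open>l\<close> has that of \<open>i\<close>, and each of the first kind is adjacent to each of the second. So
  \<open>(R\<^sup>3)\<^sub>i\<^sub>l\<close> consists of \<open>d i * d l\<close> equal terms \<open>1 / s ^ 3\<close>, where \<open>s\<^sup>2 = d i * d l\<close>, and
  their sum is \<open>1 / s = R\<^sub>i\<^sub>l\<close>.
\<close>

lemma normalized_adjacency_cube_iff:
  "R * R * R = R \<longleftrightarrow> (\<forall>i<n. \<forall>j<n. \<forall>k<n. \<forall>l<n. E i j \<longrightarrow> E j k \<longrightarrow> E k l \<longrightarrow> E i l)"
proof
  assume cube: "R * R * R = R"
  have nonneg: "0 \<le> R $$ (i, j)" if "i < n" "j < n" for i j
    using that by (simp add: R_entry d_def)
  have pos: "0 < R $$ (i, j)" if "i < n" "j < n" "E i j" for i j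
    using that d_pos[of j i] d_pos[of i j] N_sym[of i j] by (auto simp: R_entry N_def)
  show "\<forall>i<n. \<forall>j<n. \<forall>k<n. \<forall>l<n. E i j \<longrightarrow> E j k \<longrightarrow> E k l \<longrightarrow> E i l"
  proof (intro allI impI)
    fix i j k l assume *: "i < n" "j < n" "k < n" "l < n" "E i j" "E j k" "E k l"
    have "0 < R $$ (i, j) * R $$ (j, k) * R $$ (k, l)" using * pos by simp
    also have "\<dots> \<le> (\<Sum>j<n. R $$ (i, j) * R $$ (j, k) * R $$ (k, l))"
      using * nonneg by (intro member_le_sum[of j "{..<n}" "\<lambda>j. R $$ (i, j) * R $$ (j, k) * R $$ (k, l)"]) auto
    also have "\<dots> \<le> (\<Sum>k<n. \<Sum>j<n. R $$ (i, j) * R $$ (j, k) * R $$ (k, l))"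
      using * nonneg
      by (intro member_le_sum[of k "{..<n}" "\<lambda>k. \<Sum>j<n. R $$ (i, j) * R $$ (j, k) * R $$ (k, l)"])
        (auto intro!: sum_nonneg)
    also have "\<dots> = R $$ (i, l)" using R_cube_entry[OF *(1,4)] cube by simp
    finally show "E i l" using * by (auto simp: R_entry N_def split: if_splits)
  qed
next
  assume closed: "\<forall>i<n. \<forall>j<n. \<forall>k<n. \<forall>l<n. E i j \<longrightarrow> E j k \<longrightarrow> E k l \<longrightarrow> E i l"
  then have E3: "E i l" if "i < n" "j < n" "k < n" "l < n" "E i j" "E j k" "E k l" for i j k l
    using that by blast
  show "R * R * R = R"
  proof (rule eq_matI)
    fix i l assume "i < dim_row R" "l < dim_col R"
    then have il: "i < n" "l < n" by auto
    show "(R * R * R) $$ (i, l) = R $$ (i, l)"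
    proof (cases "E i l")
      case False
      have "R $$ (i, j) * R $$ (j, k) * R $$ (k, l) = 0" if "j < n" "k < n" for j k
        using E3[of i j k l] il that False by (auto simp: R_entry N_def)
      then have "(R * R * R) $$ (i, l) = 0"
        unfolding R_cube_entry[OF il] by (intro sum.neutral ballI) simp
      then show ?thesis using False il by (simp add: R_entry N_def)
    next
      case True
      have Nj: "N j = N l" if "j \<in> N i" for j
        using that True il E3[of _ j i l] E3[of _ l i j] E_sym unfolding N_def by blast
      have Nk: "N k = N i" if "k \<in> N l" for k
        using that True il E3[of _ k l i] E3[of _ i l k] E_sym unfolding N_def by blast
      define s where "s = sqrt (d i * d l)"
      have pos: "0 < d i" "0 < d l"
        using d_pos[of l i] d_pos[of i l] True il E_sym unfolding N_def by auto
      have s: "0 < s" "s * s = d i * d l" unfolding s_def using pos by auto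
      have "R $$ (i, j) * R $$ (j, k) * R $$ (k, l)
          = (if k \<in> N l then if j \<in> N i then 1 / (s * s * s) else 0 else 0)"
        if jk: "j < n" "k < n" for j k
      proof (cases "k \<in> N l \<and> j \<in> N i")
        case True
        then have "d j = d l" "d k = d i" "k \<in> N j"
          using Nj[of j] Nk[of k] by (simp_all add: d_def)
        moreover have "l \<in> N k" using True N_sym[of l k] il by blast
        ultimately show ?thesis
          using True il jk by (simp add: R_entry s_def mult.commute[of "d l"])
      next
        case False
        then show ?thesis using il jk N_sym[of k l] by (auto simp: R_entry)
      qed
      then have "(R * R * R) $$ (i, l) = (\<Sum>k<n. \<Sum>j<n. if k \<in> N l then if j \<in> N i then 1 / (s * s * s) else 0 else 0)"
        unfolding R_cube_entry[OF il] by (intro sum.cong refl) auto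
      also have "\<dots> = (\<Sum>k<n. if k \<in> N l then (\<Sum>j<n. if j \<in> N i then 1 / (s * s * s) else 0) else 0)"
        by (intro sum.cong refl) auto
      also have "\<dots> = (\<Sum>k\<in>N l. \<Sum>j\<in>N i. 1 / (s * s * s))"
        unfolding sum_N ..
      also have "\<dots> = (s * s) / (s * s * s)" unfolding s(2) using pos by (simp add: d_def)
      also have "\<dots> = 1 / s" using s(1) by simp
      finally show ?thesis using True il by (simp add: R_entry N_def s_def)
    qed
  qed auto
qed

end

section \<open>Complete bipartite graphs and the Randic energy\<close>

text \<open>
  Arcs leaving \<open>v\<close> and neighbours of \<open>v\<close> correspond one to one because there are no parallel arcs.
\<close>

lemma (in graph) vertex_degree_card_neighbours:
  "vertex_degree G v = card {w. v \<rightarrow> w}"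
proof -
  have "inj_on (head G) (out_arcs G v)"
    by (rule inj_onI) (auto simp: out_arcs_def arc_to_ends_def intro: no_multi_arcs)
  moreover have "head G ` out_arcs G v = {w. v \<rightarrow> w}"
    unfolding out_arcs_def arcs_ends_conv by force
  ultimately show ?thesis
    unfolding vertex_degree_def out_degree_def by (metis card_image)
qed

text \<open>
  Fix an edge \<open>a b\<close>. By the closure property a step from a neighbour of \<open>b\<close> leads to a neighbour of
  \<open>a\<close>, and conversely; so by connectedness the two neighbourhoods cover all vertices. A common
  neighbour \<open>w\<close> would give the walk \<open>b, w, a, b\<close> and hence a loop. Finally, \<open>x, b, a, y\<close> is a walk
  for every \<open>x\<close> adjacent to \<open>b\<close> and \<open>y\<close> adjacent to \<open>a\<close>, so all edges between the parts are present.
\<close>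

lemma (in graph) complete_bipartite_iff_three_walks_closed:
  assumes conn: "Digraph_Component.connected G" and two: "card (verts G) \<ge> 2"
  shows "(\<exists>n1 n2. n1 \<ge> 1 \<and> n2 \<ge> 1 \<and> complete_bipartite_digraph n1 n2 G) \<longleftrightarrow>
    (\<forall>u v w x. u \<rightarrow> v \<longrightarrow> v \<rightarrow> w \<longrightarrow> w \<rightarrow> x \<longrightarrow> u \<rightarrow> x)"
proof
  assume "\<exists>n1 n2. n1 \<ge> 1 \<and> n2 \<ge> 1 \<and> complete_bipartite_digraph n1 n2 G"
  then obtain U V where "U \<inter> V = {}" "arcs_ends G = U \<times> V \<union> V \<times> U"
    unfolding complete_bipartite_digraph_def by blast
  then show "\<forall>u v w x. u \<rightarrow> v \<longrightarrow> v \<rightarrow> w \<longrightarrow> w \<rightarrow> x \<longrightarrow> u \<rightarrow> x" by auto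
next
  assume closed: "\<forall>u v w x. u \<rightarrow> v \<longrightarrow> v \<rightarrow> w \<longrightarrow> w \<rightarrow> x \<longrightarrow> u \<rightarrow> x"
  have sym: "v \<rightarrow> u" if "u \<rightarrow> v" for u v
    using arcs_ends_symmetric[OF sym_arcs that] .
  have reach: "u \<rightarrow>\<^sup>* v" if "u \<in> verts G" "v \<in> verts G" for u v
    using conn that reachable_mk_symmetric_eq[OF sym_arcs]
    unfolding Digraph_Component.connected_def strongly_connected_def by simp
  obtain a where a: "a \<in> verts G" using two by fastforce
  have "verts G \<noteq> {a}" using two by auto
  then obtain a' where "a' \<in> verts G" "a' \<noteq> a" using a by blast
  then obtain b where ab: "a \<rightarrow> b"
    using reach[OF a] by (metis converse_reachable_cases)
  \<comment> \<open>the part containing \<open>a\<close> is the neighbourhood of \<open>b\<close>, and conversely\<close>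
  define U where "U = {w. b \<rightarrow> w}"
  define V where "V = {w. a \<rightarrow> w}"
  have UV: "y \<in> V" if "x \<in> U" "x \<rightarrow> y" for x y
    using closed ab that unfolding U_def V_def by blast
  have VU: "y \<in> U" if "x \<in> V" "x \<rightarrow> y" for x y
    using closed sym[OF ab] that unfolding U_def V_def by blast
  have cover: "w \<in> U \<union> V" if "a \<rightarrow>\<^sup>* w" for w
    using that
  proof (induction rule: reachable_induct)
    case base
    then show ?case using sym[OF ab] unfolding U_def by simp
  next
    case (step x y)
    then show ?case using UV VU by blast
  qed
  have verts: "verts G = U \<union> V"
    using cover reach[OF a] adj_in_verts unfolding U_def V_def by blast
  have disj: "U \<inter> V = {}"
    using closed sym ab adj_not_same unfolding U_def V_def by blast
  have arcs: "arcs_ends G = U \<times> V \<union> V \<times> U"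
  proof (intro equalityI subrelI)
    fix x y assume xy: "(x, y) \<in> arcs_ends G"
    then have "x \<in> U \<union> V" using adj_in_verts verts by auto
    then show "(x, y) \<in> U \<times> V \<union> V \<times> U" using UV VU xy by blast
  next
    fix x y assume "(x, y) \<in> U \<times> V \<union> V \<times> U"
    then show "(x, y) \<in> arcs_ends G"
      using closed sym ab unfolding U_def V_def by blast
  qed
  have "finite U" "finite V" using finite_verts verts by (metis finite_Un)+
  moreover have "a \<in> U" "b \<in> V" using ab sym unfolding U_def V_def by auto
  ultimately have "card U \<ge> 1" "card V \<ge> 1"
    by (auto simp: Suc_le_eq card_gt_0_iff)
  moreover have "complete_bipartite_digraph (card U) (card V) G"
    unfolding complete_bipartite_digraph_def
    using verts disj arcs graph_axioms by blast
  ultimately show "\<exists>n1 n2. n1 \<ge> 1 \<and> n2 \<ge> 1 \<and> complete_bipartite_digraph n1 n2 G" by blast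
qed

lemma (in graph) randic_matrix_eq_normalized_adjacency:
  assumes "distinct vs" "set vs = verts G"
  shows "card {k. k < length vs \<and> v \<rightarrow> vs ! k} = vertex_degree G v"
    and "randic_matrix G vs = normalized_adjacency (length vs) (\<lambda>i j. vs ! i \<rightarrow> vs ! j)"
proof -
  have deg: "card {k. k < length vs \<and> v \<rightarrow> vs ! k} = vertex_degree G v" for v
  proof -
    have "inj_on ((!) vs) {k. k < length vs \<and> v \<rightarrow> vs ! k}"
      using assms(1) by (auto simp: inj_on_def nth_eq_iff_index_eq)
    moreover have "(!) vs ` {k. k < length vs \<and> v \<rightarrow> vs ! k} = {w. v \<rightarrow> w}"
    proof (intro equalityI subsetI)
      fix w assume "w \<in> {w. v \<rightarrow> w}"
      then have "w \<in> set vs" "v \<rightarrow> w" using assms(2) adj_in_verts(2) by auto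
      then show "w \<in> (!) vs ` {k. k < length vs \<and> v \<rightarrow> vs ! k}"
        by (auto simp: in_set_conv_nth)
    qed auto
    ultimately show ?thesis
      unfolding vertex_degree_card_neighbours
      by (intro bij_betw_same_card[of "(!) vs"]) (simp add: bij_betw_def)
  qed
  then show "card {k. k < length vs \<and> v \<rightarrow> vs ! k} = vertex_degree G v" .
  show "randic_matrix G vs = normalized_adjacency (length vs) (\<lambda>i j. vs ! i \<rightarrow> vs ! j)"
    unfolding randic_matrix_def normalized_adjacency_def deg ..
qed

theorem theorem3p7:
  fixes G :: "('v, 'e) pre_digraph" and vs :: "'v list"
  assumes "graph G" and "Digraph_Component.connected G" and "card (verts G) \<ge> 2"
    and "distinct vs" and "set vs = verts G"
  defines "bound \<equiv> \<lambda>i. 1 / real (vertex_degree G (vs ! i)) *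
    (\<Sum>j | j < length vs \<and> vs ! j \<rightarrow>\<^bsub>G\<^esub> vs ! i. 1 / real (vertex_degree G (vs ! j)))"
  shows "(\<forall>i < length vs. randic_energy G vs i \<ge> bound i) \<and>
    ((\<forall>i < length vs. randic_energy G vs i = bound i) \<longleftrightarrow>
      (\<exists>n1 n2. n1 \<ge> 1 \<and> n2 \<ge> 1 \<and> complete_bipartite_digraph n1 n2 G))"
proof -
  interpret graph G by fact
  define E where "E = (\<lambda>i j. vs ! i \<rightarrow>\<^bsub>G\<^esub> vs ! j)"
  define R where "R = randic_matrix G vs"
  have R: "R = normalized_adjacency (length vs) E"
    unfolding R_def E_def by (rule randic_matrix_eq_normalized_adjacency(2)[OF assms(4,5)])
  have E_sym: "E j i" if "E i j" for i j
    using that arcs_ends_symmetric[OF sym_arcs] unfolding E_def by blast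
  have Rc: "R \<in> carrier_mat (length vs) (length vs)"
    unfolding R_def randic_matrix_def by simp
  note sym = normalized_adjacency_symmetric[of E "length vs", OF E_sym, folded R]
  note contr = normalized_adjacency_contraction[of E _ "length vs", OF E_sym, folded R]
  have bound: "(R * R) $$ (i, i) = bound i" if "i < length vs" for i
    using normalized_adjacency_square_diag[of E i "length vs", OF E_sym that, folded R]
    unfolding bound_def E_def randic_matrix_eq_normalized_adjacency(1)[OF assms(4,5)] .
  have vertex: "\<exists>i<length vs. vs ! i = v" if "v \<in> verts G" for v
    using that assms(5) by (metis in_set_conv_nth)
  have "(\<forall>i<length vs. randic_energy G vs i = bound i) \<longleftrightarrow> R * R * R = R"
    using mat_abs_diag_eq_square_iff[OF Rc sym contr] bound
    unfolding randic_energy_def R_def[symmetric] by auto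
  also have "\<dots> \<longleftrightarrow> (\<forall>i<length vs. \<forall>j<length vs. \<forall>k<length vs. \<forall>l<length vs.
      E i j \<longrightarrow> E j k \<longrightarrow> E k l \<longrightarrow> E i l)"
    unfolding R by (rule normalized_adjacency_cube_iff) (rule E_sym)
  also have "\<dots> \<longleftrightarrow> (\<forall>u v w x. u \<rightarrow>\<^bsub>G\<^esub> v \<longrightarrow> v \<rightarrow>\<^bsub>G\<^esub> w \<longrightarrow> w \<rightarrow>\<^bsub>G\<^esub> x \<longrightarrow> u \<rightarrow>\<^bsub>G\<^esub> x)"
  proof
    assume idx: "\<forall>i<length vs. \<forall>j<length vs. \<forall>k<length vs. \<forall>l<length vs.
      E i j \<longrightarrow> E j k \<longrightarrow> E k l \<longrightarrow> E i l"
    show "\<forall>u v w x. u \<rightarrow>\<^bsub>G\<^esub> v \<longrightarrow> v \<rightarrow>\<^bsub>G\<^esub> w \<longrightarrow> w \<rightarrow>\<^bsub>G\<^esub> x \<longrightarrow> u \<rightarrow>\<^bsub>G\<^esub> x"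
    proof (intro allI impI)
      fix u v w x assume *: "u \<rightarrow>\<^bsub>G\<^esub> v" "v \<rightarrow>\<^bsub>G\<^esub> w" "w \<rightarrow>\<^bsub>G\<^esub> x"
      obtain i j k l where "i < length vs" "vs ! i = u" "j < length vs" "vs ! j = v"
        "k < length vs" "vs ! k = w" "l < length vs" "vs ! l = x"
        using vertex[OF adj_in_verts(1)[OF *(1)]] vertex[OF adj_in_verts(1)[OF *(2)]]
          vertex[OF adj_in_verts(1)[OF *(3)]] vertex[OF adj_in_verts(2)[OF *(3)]] by blast
      then show "u \<rightarrow>\<^bsub>G\<^esub> x" using idx * unfolding E_def by blast
    qed
  qed (unfold E_def, blast)
  also have "\<dots> \<longleftrightarrow> (\<exists>n1 n2. n1 \<ge> 1 \<and> n2 \<ge> 1 \<and> complete_bipartite_digraph n1 n2 G)"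
    using complete_bipartite_iff_three_walks_closed[OF assms(2,3)] by blast
  finally show ?thesis
    using mat_abs_diag_ge_square[OF Rc sym contr] bound
    unfolding randic_energy_def R_def[symmetric] by auto
qed

end
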